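(* For $g_1,g_2\in G^J(\mathbb{R})$ and $k_1(x),k_2(x)\in\mathfrak{a}$, if $\mathrm{Ad}(g_1)k_1(x)=\mathrm{Ad}(g_2)k_2(x)$, then $\mathrm{Im}(k_1)=\mathrm{Im}(k_2)$, where $\mathrm{Im}(k_i)\subseteq\mathbb{R}$ is the image of the polynomial $k_i(x)$ regarded as a function $k_i:\mathbb{R}\to\mathbb{R}$.
   Context: The Jacobi group $G^J(\mathbb{R})$ is $\mathrm{SL}(2,\mathbb{R})\times\mathbb{R}^2\times\mathbb{R}$ with multiplication $(M_1,X_1,\kappa_1)\cdot(M_2,X_2,\kappa_2)=(M_1M_2,X_1M_2+X_2,\kappa_1+\kappa_2+\Omega(X_1M_2,X_2))$, where elements of $\mathbb{R}^2$ are row vectors and $\Omega(\xi,\eta)=\xi_1\eta_2-\xi_2\eta_1$. Its Lie algebra is $\mathfrak{g}^J=\mathfrak{sl}(2,\mathbb{R})\times\mathbb{R}^2\times\mathbb{R}$, and $\mathrm{Ad}$ denotes the adjoint representation of $G^J(\mathbb{R})$ on $\mathfrak{g}^J$. Let $F=\big(\big[\begin{smallmatrix}0&1\\0&0\end{smallmatrix}\big],0,0\big)$, $Q=(0,(0,1),0)$, $R=(0,0,1)\in\mathfrak{g}^J$ and $\mathfrak{a}=\mathrm{Vect}_{\mathbb{R}}\{F,Q,R\}$, identified with the space of real polynomials in $x$ of degree $\le2$ via $F\mapsto-x^2$, $Q\mapsto x$, $R\mapsto-\frac14$. *)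

theory Defs
  imports
    "HOL-Analysis.Analysis"
    "HOL-Algebra.Group"
    "HOL-Computational_Algebra.Polynomial"
begin

text \<open>
  The group and its Lie algebra are both realised as subsets of the Euclidean space
  \<open>Mat(2,\<real>) \<times> \<real>\<^sup>2 \<times> \<real>\<close>; elements of \<open>\<real>\<^sup>2\<close> are row vectors, acted on from the right by \<open>v*\<close>.
\<close>

type_synonym jacobi_space = "(real^2^2) \<times> (real^2) \<times> real"

definition symp_form :: "real^2 \<Rightarrow> real^2 \<Rightarrow> real" where
  "symp_form \<xi> \<eta> = \<xi>$1 * \<eta>$2 - \<xi>$2 * \<eta>$1"

text \<open>The multiplication formula makes sense on the whole ambient space, not just on the carrier.\<close>

definition jacobi_mult :: "jacobi_space \<Rightarrow> jacobi_space \<Rightarrow> jacobi_space" where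
  "jacobi_mult = (\<lambda>(M1, X1, \<kappa>1) (M2, X2, \<kappa>2).
     (M1 ** M2, X1 v* M2 + X2, \<kappa>1 + \<kappa>2 + symp_form (X1 v* M2) X2))"

definition jacobi_group :: "jacobi_space monoid" where
  "jacobi_group =
     \<lparr>carrier = {M. det M = 1} \<times> UNIV \<times> UNIV,
      mult = jacobi_mult,
      one = (mat 1, 0, 0)\<rparr>"

definition jacobi_lie :: "jacobi_space set" where
  "jacobi_lie = {A. trace A = 0} \<times> UNIV \<times> UNIV"

text \<open>
  \<open>Ad g\<close> is the differential at the identity of \<open>h \<mapsto> g h g\<^sup>-\<^sup>1\<close>. Conjugation by \<open>g\<close> extends by the same
  formula to a smooth map of the ambient space; the derivative taken here is that of the extension,
  and its restriction to \<open>jacobi_lie\<close> is the differential of conjugation on the group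
  (see \<open>jacobi_Ad_curve\<close> and \<open>jacobi_lie_tangent\<close> below).
\<close>

definition jacobi_Ad :: "jacobi_space \<Rightarrow> jacobi_space \<Rightarrow> jacobi_space" where
  "jacobi_Ad g =
     frechet_derivative
       (\<lambda>h. g \<otimes>\<^bsub>jacobi_group\<^esub> h \<otimes>\<^bsub>jacobi_group\<^esub> inv\<^bsub>jacobi_group\<^esub> g)
       (at \<one>\<^bsub>jacobi_group\<^esub>)"

definition jacobi_F :: jacobi_space where
  "jacobi_F = (vector [vector [0, 1], vector [0, 0]], 0, 0)"

definition jacobi_Q :: jacobi_space where
  "jacobi_Q = (0, vector [0, 1], 0)"

definition jacobi_R :: jacobi_space where
  "jacobi_R = (0, 0, 1)"

definition jacobi_a :: "jacobi_space set" where
  "jacobi_a = span {jacobi_F, jacobi_Q, jacobi_R}"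

text \<open>
  The linear identification of \<open>jacobi_a\<close> with the polynomials of degree at most 2: the coordinates
  of \<open>(A, X, \<kappa>)\<close> with respect to the basis \<open>F, Q, R\<close> are \<open>A\<^sub>1\<^sub>2\<close>, \<open>X\<^sub>2\<close> and \<open>\<kappa>\<close>. The value outside
  \<open>jacobi_a\<close> is irrelevant.
\<close>

definition jacobi_poly :: "jacobi_space \<Rightarrow> real poly" where
  "jacobi_poly = (\<lambda>(A, X, \<kappa>). [: - \<kappa> / 4, X$2, - (A$1$2) :])"


lemma jacobi_poly_basis:
  "jacobi_poly jacobi_F = - monom 1 2"
  "jacobi_poly jacobi_Q = monom 1 1"
  "jacobi_poly jacobi_R = [: - 1/4 :]"
  by (simp_all add: jacobi_poly_def jacobi_F_def jacobi_Q_def jacobi_R_def vector_2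
      monom_altdef numeral_2_eq_2)

lemma jacobi_poly_linear:
  "jacobi_poly (k + l) = jacobi_poly k + jacobi_poly l"
  "jacobi_poly (c *\<^sub>R k) = smult c (jacobi_poly k)"
  by (simp_all add: jacobi_poly_def split_beta add_divide_distrib)

lemma jacobi_a_iff:
  "k \<in> jacobi_a \<longleftrightarrow> (\<exists>\<alpha> \<beta> \<gamma>. k = \<alpha> *\<^sub>R jacobi_F + \<beta> *\<^sub>R jacobi_Q + \<gamma> *\<^sub>R jacobi_R)"
proof -
  have "k - \<alpha> *\<^sub>R jacobi_F - \<beta> *\<^sub>R jacobi_Q - \<gamma> *\<^sub>R jacobi_R = 0 \<longleftrightarrow>
      k = \<alpha> *\<^sub>R jacobi_F + \<beta> *\<^sub>R jacobi_Q + \<gamma> *\<^sub>R jacobi_R" for \<alpha> \<beta> \<gamma>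
    by (simp only: diff_diff_eq right_minus_eq add.assoc)
  then show ?thesis
    by (simp add: jacobi_a_def span_insert)
qed

lemma jacobi_poly_coords:
  "jacobi_poly (\<alpha> *\<^sub>R jacobi_F + \<beta> *\<^sub>R jacobi_Q + \<gamma> *\<^sub>R jacobi_R) = [: - \<gamma> / 4, \<beta>, - \<alpha> :]"
  by (simp add: jacobi_poly_def jacobi_F_def jacobi_Q_def jacobi_R_def vector_2)

lemma jacobi_poly_bij: "bij_betw jacobi_poly jacobi_a {p. degree p \<le> 2}"
proof (rule bij_betw_imageI)
  show "inj_on jacobi_poly jacobi_a"
  proof (rule inj_onI)
    fix k l assume "k \<in> jacobi_a" "l \<in> jacobi_a" and eq: "jacobi_poly k = jacobi_poly l"
    then obtain \<alpha> \<beta> \<gamma> \<alpha>' \<beta>' \<gamma>'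
      where k: "k = \<alpha> *\<^sub>R jacobi_F + \<beta> *\<^sub>R jacobi_Q + \<gamma> *\<^sub>R jacobi_R"
        and l: "l = \<alpha>' *\<^sub>R jacobi_F + \<beta>' *\<^sub>R jacobi_Q + \<gamma>' *\<^sub>R jacobi_R"
      unfolding jacobi_a_iff by blast
    from eq have "\<alpha> = \<alpha>'" "\<beta> = \<beta>'" "\<gamma> = \<gamma>'"
      unfolding k l jacobi_poly_coords by simp_all
    then show "k = l" by (simp add: k l)
  qed
  show "jacobi_poly ` jacobi_a = {p. degree p \<le> 2}"
  proof (intro equalityI subsetI)
    fix p assume "p \<in> jacobi_poly ` jacobi_a"
    then show "p \<in> {p. degree p \<le> 2}"
      by (auto simp: jacobi_a_iff jacobi_poly_coords)
  next
    fix p :: "real poly" assume "p \<in> {p. degree p \<le> 2}"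
    then have "p = [: coeff p 0, coeff p 1, coeff p 2 :]"
      by (intro poly_eqI) (auto simp: coeff_pCons numeral_2_eq_2 coeff_eq_0 split: nat.split)
    also have "\<dots> = jacobi_poly ((- coeff p 2) *\<^sub>R jacobi_F + coeff p 1 *\<^sub>R jacobi_Q
        + (- 4 * coeff p 0) *\<^sub>R jacobi_R)"
      unfolding jacobi_poly_coords by simp
    finally show "p \<in> jacobi_poly ` jacobi_a"
      unfolding image_iff jacobi_a_iff Bex_def by blast
  qed
qed

lemma jacobi_a_subset: "jacobi_a \<subseteq> jacobi_lie"
  by (auto simp: jacobi_a_iff jacobi_lie_def jacobi_F_def jacobi_Q_def jacobi_R_def
      trace_def sum_2 vector_2)


lemma symp_form_self: "symp_form u u = 0"
  and symp_form_uminus: "symp_form (- u) v = - symp_form u v" "symp_form u (- v) = - symp_form u v"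
  and symp_form_0: "symp_form 0 v = 0" "symp_form u 0 = 0"
  and symp_form_add: "symp_form (u + u') v = symp_form u v + symp_form u' v"
    "symp_form u (v + v') = symp_form u v + symp_form u v'"
  by (simp_all add: symp_form_def algebra_simps)

lemma symp_form_det: "symp_form (u v* M) (v v* M) = det M * symp_form u v"
  by (simp add: symp_form_def det_2 vector_matrix_mult_def sum_2 algebra_simps)

lemma row_mult_uminus: "(- u) v* (M :: real^2^2) = - (u v* M)"
  by (simp add: vec_eq_iff vector_matrix_mult_def sum_negf)

lemma row_mult_add: "(u + v) v* (M :: real^2^2) = u v* M + v v* M"
  by (simp add: vec_eq_iff vector_matrix_mult_def sum.distrib algebra_simps)

lemma row_mult_assoc: "(u v* (M :: real^2^2)) v* N = u v* (M ** N)"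
  by (simp add: vector_matrix_mul_assoc)

lemma row_mult_one: "(u :: real^2) v* mat 1 = u"
  by simp

lemma jacobi_group: "group jacobi_group"
proof (rule groupI)
  fix x y z
  assume "x \<in> carrier jacobi_group" "y \<in> carrier jacobi_group" "z \<in> carrier jacobi_group"
  then obtain M1 X1 \<kappa>1 M2 X2 \<kappa>2 M3 X3 \<kappa>3
    where xyz: "x = (M1, X1, \<kappa>1)" "y = (M2, X2, \<kappa>2)" "z = (M3, X3, \<kappa>3)" and d: "det M3 = 1"
    by (auto simp: jacobi_group_def)
  have "symp_form (X1 v* (M2 ** M3)) (X2 v* M3) = symp_form (X1 v* M2) X2"
    using symp_form_det[of "X1 v* M2" M3 X2] d by (simp add: row_mult_assoc)
  then show "x \<otimes>\<^bsub>jacobi_group\<^esub> y \<otimes>\<^bsub>jacobi_group\<^esub> z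
      = x \<otimes>\<^bsub>jacobi_group\<^esub> (y \<otimes>\<^bsub>jacobi_group\<^esub> z)"
    by (simp add: xyz jacobi_group_def jacobi_mult_def matrix_mul_assoc row_mult_add
        row_mult_assoc symp_form_add)
next
  fix x assume "x \<in> carrier jacobi_group"
  then obtain M X \<kappa> where x: "x = (M, X, \<kappa>)" and d: "det M = 1"
    by (auto simp: jacobi_group_def)
  then have "invertible M" by (simp add: invertible_det_nz)
  then obtain N where N: "N ** M = mat 1" by (auto simp: invertible_def)
  let ?y = "(N, - (X v* N), - \<kappa>)"
  have "det N = 1"
    using d N by (metis det_I det_mul mult.right_neutral)
  then have "?y \<in> carrier jacobi_group" by (simp add: jacobi_group_def)
  moreover have "?y \<otimes>\<^bsub>jacobi_group\<^esub> x = \<one>\<^bsub>jacobi_group\<^esub>"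
    using N
    by (simp add: x jacobi_group_def jacobi_mult_def row_mult_uminus row_mult_assoc
        row_mult_one symp_form_uminus symp_form_self)
  ultimately show "\<exists>y\<in>carrier jacobi_group. y \<otimes>\<^bsub>jacobi_group\<^esub> x = \<one>\<^bsub>jacobi_group\<^esub>" by blast
qed (auto simp: jacobi_group_def jacobi_mult_def det_mul symp_form_0)

lemma jacobi_conj_differentiable:
  "(\<lambda>h. g \<otimes>\<^bsub>jacobi_group\<^esub> h \<otimes>\<^bsub>jacobi_group\<^esub> g') differentiable (at h0)"
proof -
  obtain M X \<kappa> where g: "g = (M, X, \<kappa>)" by (cases g)
  obtain M' X' \<kappa>' where g': "g' = (M', X', \<kappa>')" by (cases g')
  have bl1: "bounded_linear (\<lambda>A :: real^2^2. M ** A ** M')"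
    by (intro linear_conv_bounded_linear[THEN iffD1] linearI)
      (simp_all add: vec_eq_iff matrix_matrix_mult_def sum_2 algebra_simps)
  have bl2: "bounded_linear (\<lambda>A :: real^2^2. X v* A)"
    by (intro linear_conv_bounded_linear[THEN iffD1] linearI)
      (simp_all add: vec_eq_iff vector_matrix_mult_def sum_2 algebra_simps)
  have bl3: "bounded_linear (\<lambda>u :: real^2. u v* M')"
    by (intro linear_conv_bounded_linear[THEN iffD1] linearI)
      (simp_all add: vec_eq_iff vector_matrix_mult_def sum_2 algebra_simps)
  have bl4: "bounded_linear (\<lambda>u. symp_form u X')"
    by (intro linear_conv_bounded_linear[THEN iffD1] linearI)
      (simp_all add: symp_form_def algebra_simps)
  have bb: "bounded_bilinear symp_form"
    by (intro bilinear_conv_bounded_bilinear[THEN iffD1])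
      (simp add: bilinear_def linear_iff symp_form_def algebra_simps)
  note rules =
    bounded_linear.has_derivative[OF bl1] bounded_linear.has_derivative[OF bl2]
    bounded_linear.has_derivative[OF bl3] bounded_linear.has_derivative[OF bl4]
    bounded_bilinear.FDERIV[OF bb] has_derivative_Pair has_derivative_add
    has_derivative_fst has_derivative_snd has_derivative_ident has_derivative_const
  have conj_eq: "(\<lambda>h. g \<otimes>\<^bsub>jacobi_group\<^esub> h \<otimes>\<^bsub>jacobi_group\<^esub> g') =
    (\<lambda>h. (M ** fst h ** M', (X v* fst h + fst (snd h)) v* M' + X',
        \<kappa> + snd (snd h) + symp_form (X v* fst h) (fst (snd h)) + \<kappa>'
          + symp_form ((X v* fst h + fst (snd h)) v* M') X'))"
    by (simp add: fun_eq_iff g g' jacobi_group_def jacobi_mult_def)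
  show ?thesis
    unfolding conj_eq differentiable_def by (rule exI, (rule rules)+)
qed

lemma jacobi_Ad_has_derivative:
  "((\<lambda>h. g \<otimes>\<^bsub>jacobi_group\<^esub> h \<otimes>\<^bsub>jacobi_group\<^esub> inv\<^bsub>jacobi_group\<^esub> g) has_derivative jacobi_Ad g)
     (at \<one>\<^bsub>jacobi_group\<^esub>)"
  unfolding jacobi_Ad_def frechet_derivative_works[symmetric]
  by (rule jacobi_conj_differentiable)

lemma jacobi_Ad_curve:
  assumes "c 0 = \<one>\<^bsub>jacobi_group\<^esub>" and "(c has_vector_derivative Y) (at 0)"
  shows "((\<lambda>t. g \<otimes>\<^bsub>jacobi_group\<^esub> c t \<otimes>\<^bsub>jacobi_group\<^esub> inv\<^bsub>jacobi_group\<^esub> g)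
           has_vector_derivative jacobi_Ad g Y) (at 0)"
proof -
  have "((\<lambda>h. g \<otimes>\<^bsub>jacobi_group\<^esub> h \<otimes>\<^bsub>jacobi_group\<^esub> inv\<^bsub>jacobi_group\<^esub> g)
      has_derivative jacobi_Ad g) (at (c 0))"
    using jacobi_Ad_has_derivative assms(1) by simp
  from vector_derivative_diff_chain_within[OF assms(2)
      has_derivative_at_withinI[OF this]]
  show ?thesis by (simp add: o_def)
qed

lemma jacobi_lie_tangent:
  assumes "\<And>t. c t \<in> carrier jacobi_group" and "c 0 = \<one>\<^bsub>jacobi_group\<^esub>"
    and "(c has_vector_derivative Y) (at 0)"
  shows "Y \<in> jacobi_lie"
proof -
  have e: "((\<lambda>t. fst (c t) $ i $ j) has_vector_derivative fst Y $ i $ j) (at 0)" for i j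
    by (intro bounded_linear.has_vector_derivative[OF _ assms(3)])
      (intro bounded_linear_intros bounded_linear_compose[OF bounded_linear_vec_nth]
        bounded_linear_fst)
  have d: "((\<lambda>t. fst (c t) $ i $ j) has_real_derivative fst Y $ i $ j) (at 0)" for i j
    using e by (simp add: has_real_derivative_iff_has_vector_derivative)
  have c0: "fst (c 0) = mat 1" using assms(2) by (simp add: jacobi_group_def)
  have "((\<lambda>t. det (fst (c t))) has_real_derivative trace (fst Y)) (at 0)"
    unfolding det_2
    using DERIV_diff[OF DERIV_mult[OF d[of 1 1] d[of 2 2]] DERIV_mult[OF d[of 1 2] d[of 2 1]]]
    by (simp add: c0 mat_def trace_def sum_2 add.commute)
  moreover have "(\<lambda>t. det (fst (c t))) = (\<lambda>t. 1)"
    using assms(1) by (auto simp: fun_eq_iff jacobi_group_def mem_Times_iff)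
  ultimately have "trace (fst Y) = 0"
    by (metis DERIV_const DERIV_unique)
  then show ?thesis by (simp add: jacobi_lie_def mem_Times_iff)
qed

end

(*
  Writing k = alpha F + beta Q + gamma R and letting g have matrix part M with first column (a, c) and
  vector part with first entry p, the element Ad(g) k has coordinates
    alpha (-ac, a^2, -c^2),  (beta + alpha p) (-c, a),  gamma + 2 p beta + alpha p^2.
  The coefficients alpha, beta + alpha p, gamma + 2 p beta + alpha p^2 are those of the translate
  k(x - p/2), so the vector part does not affect the image of the polynomial. If two such elements
  coincide, then either the translates are constant and equal or the columns (a1, c1), (a2, c2) are
  proportional, and the translates differ by a rescaling of the variable.
*)
theory Submission
  imports Defs
begin

lemma jacobi_group_inv:
  assumes "det M = 1" and "N ** M = mat 1"
  shows "inv\<^bsub>jacobi_group\<^esub> (M, X, \<kappa>) = (N, - (X v* N), - \<kappa>)"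
proof (rule group.inv_equality[OF jacobi_group])
  have "det N = 1"
    using assms by (metis det_I det_mul mult.right_neutral)
  then show "(N, - (X v* N), - \<kappa>) \<in> carrier jacobi_group"
    by (simp add: jacobi_group_def)
  show "(M, X, \<kappa>) \<in> carrier jacobi_group"
    using assms by (simp add: jacobi_group_def)
  show "(N, - (X v* N), - \<kappa>) \<otimes>\<^bsub>jacobi_group\<^esub> (M, X, \<kappa>) = \<one>\<^bsub>jacobi_group\<^esub>"
    using assms
    by (simp add: jacobi_group_def jacobi_mult_def row_mult_uminus row_mult_assoc
        symp_form_uminus symp_form_self)
qed

text \<open>Conjugating the straight line through the identity with direction
  \<open>(A, Y, \<gamma>)\<close> gives a polynomial in \<open>t\<close> of degree at most 2, whose
  linear coefficient is the derivative sought. The line need not stay in the group: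
  \<open>jacobi_Ad\<close> differentiates the extension of conjugation to the ambient space.\<close>

lemma jacobi_Ad_eq:
  assumes "det M = 1" and NM: "N ** M = mat 1"
  shows "jacobi_Ad (M, X, \<kappa>) (A, Y, \<gamma>) =
    (M ** A ** N, (X v* A + Y) v* N, \<gamma> + 2 * symp_form X Y - symp_form (X v* A) X)"
    (is "_ = ?L")
proof -
  define c :: "real \<Rightarrow> jacobi_space" where "c = (\<lambda>t. (mat 1, 0, 0) + t *\<^sub>R (A, Y, \<gamma>))"
  \<comment> \<open>The coefficient of \<open>t\<^sup>2\<close>: the cocycle pairs the two
    first-order terms \<open>X v* A\<close> and \<open>Y\<close>.\<close>
  define W :: jacobi_space where "W = (0, 0, symp_form (X v* A) Y)"
  let ?conj = "\<lambda>h. (M, X, \<kappa>) \<otimes>\<^bsub>jacobi_group\<^esub> h \<otimes>\<^bsub>jacobi_group\<^esub> inv\<^bsub>jacobi_group\<^esub> (M, X, \<kappa>)"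
  have MN: "M ** N = mat 1"
    using NM matrix_left_right_inverse by blast
  have detN: "det N = 1"
    using assms by (metis det_I det_mul mult.right_neutral)
  have scale: "symp_form (t *\<^sub>R u) v = t * symp_form u v" "symp_form u (t *\<^sub>R v) = t * symp_form u v"
    for t u v by (simp_all add: symp_form_def algebra_simps)
  have swap: "symp_form Y X = - symp_form X Y"
    by (simp add: symp_form_def)
  define u where "u = X v* A"
  have conj_c: "?conj (c t) = (mat 1, 0, 0) + t *\<^sub>R ?L + t\<^sup>2 *\<^sub>R W" for t
  proof -
    have row: "X v* (mat 1 + t *\<^sub>R A) = X + t *\<^sub>R u"
      by (simp add: u_def vec_eq_iff vector_matrix_mult_def sum_2 mat_def algebra_simps forall_2)
    have "M ** (mat 1 + t *\<^sub>R A) ** N = M ** N + t *\<^sub>R (M ** A ** N)"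
      by (simp add: vec_eq_iff mat_def matrix_matrix_mult_def sum_2 forall_2 algebra_simps)
    then have 1: "M ** (mat 1 + t *\<^sub>R A) ** N = mat 1 + t *\<^sub>R (M ** A ** N)"
      by (simp add: MN)
    have 2: "(X + t *\<^sub>R u + t *\<^sub>R Y) v* N = X v* N + t *\<^sub>R ((u + Y) v* N)"
      by (simp add: vec_eq_iff vector_matrix_mult_def sum_2 forall_2 algebra_simps)
    \<comment> \<open>As \<open>det N = 1\<close>, the common factor \<open>N\<close> drops out of
      the symplectic form, and \<open>symp_form X X = 0\<close> removes the term of order
      zero.\<close>
    have 3: "symp_form ((X + t *\<^sub>R u + t *\<^sub>R Y) v* N) (X v* N) = t * symp_form u X - t * symp_form X Y"
      by (simp only: symp_form_det detN symp_form_add scale swap symp_form_self)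
        (simp add: algebra_simps)
    have "?conj (c t) = (M ** (mat 1 + t *\<^sub>R A) ** N,
        (X + t *\<^sub>R u + t *\<^sub>R Y) v* N - X v* N,
        t * \<gamma> + symp_form (X + t *\<^sub>R u) (t *\<^sub>R Y)
          - symp_form ((X + t *\<^sub>R u + t *\<^sub>R Y) v* N) (X v* N))"
      unfolding jacobi_group_inv[OF assms]
      by (simp add: c_def jacobi_group_def jacobi_mult_def row symp_form_uminus)
    also have "\<dots> = (mat 1 + t *\<^sub>R (M ** A ** N), t *\<^sub>R ((u + Y) v* N),
        t * (\<gamma> + 2 * symp_form X Y - symp_form u X) + t\<^sup>2 * symp_form u Y)"
      \<comment> \<open>The left side of \<open>2\<close> occurs inside that of \<open>3\<close>, so
        \<open>3\<close> must be applied first.\<close>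
      unfolding 1 3 unfolding 2
      by (simp only: symp_form_add scale Pair_inject) (simp add: power2_eq_square algebra_simps)
    finally show ?thesis
      by (simp add: W_def u_def)
  qed
  have "((\<lambda>t. ?conj (c t)) has_vector_derivative jacobi_Ad (M, X, \<kappa>) (A, Y, \<gamma>)) (at 0)"
  proof (rule jacobi_Ad_curve)
    show "c 0 = \<one>\<^bsub>jacobi_group\<^esub>"
      by (simp add: c_def jacobi_group_def zero_prod_def)
    show "(c has_vector_derivative (A, Y, \<gamma>)) (at 0)"
      unfolding c_def by (auto intro!: derivative_eq_intros)
  qed
  moreover have "((\<lambda>t. (mat 1, 0, 0) + t *\<^sub>R ?L + t\<^sup>2 *\<^sub>R W) has_vector_derivative ?L) (at 0)"
    by (auto intro!: derivative_eq_intros)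
  ultimately show ?thesis
    unfolding conj_c by (rule vector_derivative_unique_at)
qed

text \<open>Here \<open>A\<close> is \<alpha> times the matrix unit at (1,2), so the matrix part is
  \<alpha> times the first column of \<open>M\<close> times the second row \<open>(-c, a)\<close> of
  its inverse. Since \<open>X v* A\<close> is \<open>(0, \<alpha> * p)\<close>, the vector part is a
  multiple of that same row.\<close>

lemma jacobi_Ad_a:
  fixes M :: "real^2^2" and X :: "real^2" and \<alpha> \<beta> \<gamma> \<kappa> :: real
  assumes "det M = 1"
  defines "k \<equiv> \<alpha> *\<^sub>R jacobi_F + \<beta> *\<^sub>R jacobi_Q + \<gamma> *\<^sub>R jacobi_R"
  defines "a \<equiv> M$1$1" and "c \<equiv> M$2$1" and "p \<equiv> X$1"
  shows "jacobi_Ad (M, X, \<kappa>) k =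
    (vector [vector [- (\<alpha> * (a * c)), \<alpha> * a\<^sup>2], vector [- (\<alpha> * c\<^sup>2), \<alpha> * (a * c)]],
     vector [- ((\<beta> + \<alpha> * p) * c), (\<beta> + \<alpha> * p) * a],
     \<gamma> + 2 * p * \<beta> + \<alpha> * p\<^sup>2)"
proof -
  \<comment> \<open>The adjugate of \<open>M\<close>, which is its inverse because the determinant
    is 1.\<close>
  define N :: "real^2^2" where "N = vector [vector [M$2$2, - M$1$2], vector [- M$2$1, M$1$1]]"
  have "N ** M = mat 1"
    using assms(1)
    by (simp add: N_def vec_eq_iff forall_2 matrix_matrix_mult_def sum_2 mat_def det_2 algebra_simps)
  note Ad = jacobi_Ad_eq[OF assms(1) this]
  have "k = (vector [vector [0, \<alpha>], vector [0, 0]], vector [0, \<beta>], \<gamma>)"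
    by (simp add: k_def jacobi_F_def jacobi_Q_def jacobi_R_def vec_eq_iff forall_2)
  then show ?thesis
    by (simp add: Ad N_def a_def c_def p_def vec_eq_iff forall_2
        matrix_matrix_mult_def vector_matrix_mult_def symp_form_def sum_2 power2_eq_square
        algebra_simps)
qed

lemma range_comp_surj: "surj h \<Longrightarrow> range (\<lambda>x. f (h x)) = range f"
  by (metis image_image)

text \<open>The substitution of \<open>x - p / 2\<close> is a bijection of the line. The factor -1/4
  attached to \<open>jacobi_R\<close> makes the third coordinate of \<open>jacobi_Ad_a\<close> yield
  the constant term of the translate.\<close>

lemma range_poly_translate:
  fixes \<alpha> \<beta> \<gamma> p :: real
  shows "range (poly [: - \<gamma> / 4, \<beta>, - \<alpha> :]) =
    range (poly [: - (\<gamma> + 2 * p * \<beta> + \<alpha> * p\<^sup>2) / 4, \<beta> + \<alpha> * p, - \<alpha> :])"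
proof -
  have "surj (\<lambda>x. x - p / 2)"
    by (rule surjI[of _ "\<lambda>x. x + p / 2"]) simp
  moreover have "poly [: - \<gamma> / 4, \<beta>, - \<alpha> :] (x - p / 2) =
      poly [: - (\<gamma> + 2 * p * \<beta> + \<alpha> * p\<^sup>2) / 4, \<beta> + \<alpha> * p, - \<alpha> :] x" for x
    by (simp add: field_simps power2_eq_square)
  ultimately show ?thesis
    using range_comp_surj[of "\<lambda>x. x - p / 2" "poly [: - \<gamma> / 4, \<beta>, - \<alpha> :]"] by simp
qed

lemma range_poly_rescale:
  fixes \<alpha> \<beta> \<gamma> l :: real
  assumes "l \<noteq> 0"
  shows "range (poly [: \<gamma>, l * \<beta>, - (l\<^sup>2 * \<alpha>) :]) = range (poly [: \<gamma>, \<beta>, - \<alpha> :])"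
proof -
  have "surj (\<lambda>x. l * x)"
    using assms by (intro surjI[of _ "\<lambda>x. x / l"]) simp
  from range_comp_surj[OF this, of "poly [: \<gamma>, \<beta>, - \<alpha> :]"] show ?thesis
    by (simp add: algebra_simps power2_eq_square)
qed

text \<open>Phrased for a single entry of the column, so that it serves for the upper and the lower
  one alike.\<close>

lemma rescaling_factor:
  fixes a1 a2 \<alpha>1 \<alpha>2 \<beta>1 \<beta>2 :: real
  assumes "\<alpha>1 * a1\<^sup>2 = \<alpha>2 * a2\<^sup>2" and "\<beta>1 * a1 = \<beta>2 * a2"
    and "a1 \<noteq> 0" and "\<alpha>1 \<noteq> 0 \<or> \<beta>1 \<noteq> 0"
  shows "\<exists>l. l \<noteq> 0 \<and> \<alpha>1 = l\<^sup>2 * \<alpha>2 \<and> \<beta>1 = l * \<beta>2"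
proof (intro exI conjI)
  \<comment> \<open>If \<open>a2\<close> vanished, the two equations would force both \<alpha>1 and
    \<beta>1 to vanish.\<close>
  show "a2 / a1 \<noteq> 0" using assms by auto
  show "\<alpha>1 = (a2 / a1)\<^sup>2 * \<alpha>2" "\<beta>1 = a2 / a1 * \<beta>2"
    using assms by (simp_all add: field_simps)
qed

theorem lemma3p50:
  fixes g1 g2 k1 k2 :: jacobi_space
  assumes "g1 \<in> carrier jacobi_group" and "g2 \<in> carrier jacobi_group"
    and "k1 \<in> jacobi_a" and "k2 \<in> jacobi_a"
    and "jacobi_Ad g1 k1 = jacobi_Ad g2 k2"
  shows "range (poly (jacobi_poly k1)) = range (poly (jacobi_poly k2))"
proof -
  obtain M1 X1 \<kappa>1 M2 X2 \<kappa>2 where g: "g1 = (M1, X1, \<kappa>1)" "g2 = (M2, X2, \<kappa>2)"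
    by (metis prod_cases3)
  have det: "det M1 = 1" "det M2 = 1"
    using assms(1,2) by (auto simp: g jacobi_group_def)
  obtain \<alpha>1 \<beta>1 \<gamma>1 \<alpha>2 \<beta>2 \<gamma>2
    where k1: "k1 = \<alpha>1 *\<^sub>R jacobi_F + \<beta>1 *\<^sub>R jacobi_Q + \<gamma>1 *\<^sub>R jacobi_R"
      and k2: "k2 = \<alpha>2 *\<^sub>R jacobi_F + \<beta>2 *\<^sub>R jacobi_Q + \<gamma>2 *\<^sub>R jacobi_R"
    using assms(3,4) unfolding jacobi_a_iff by blast
  define a1 c1 a2 c2 where "a1 = M1$1$1" and "c1 = M1$2$1" and "a2 = M2$1$1" and "c2 = M2$2$1"
  define b1 where "b1 = \<beta>1 + \<alpha>1 * X1$1"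
  define b2 where "b2 = \<beta>2 + \<alpha>2 * X2$1"
  define d1 where "d1 = \<gamma>1 + 2 * X1$1 * \<beta>1 + \<alpha>1 * (X1$1)\<^sup>2"
  define d2 where "d2 = \<gamma>2 + 2 * X2$1 * \<beta>2 + \<alpha>2 * (X2$1)\<^sup>2"
  \<comment> \<open>The off-diagonal matrix entries and the vector entries separate the columns:
    \<open>eqs(1,3)\<close> involve only upper entries, \<open>eqs(2,4)\<close> only lower
    ones.\<close>
  have eqs: "\<alpha>1 * a1\<^sup>2 = \<alpha>2 * a2\<^sup>2" "\<alpha>1 * c1\<^sup>2 = \<alpha>2 * c2\<^sup>2" "b1 * a1 = b2 * a2" "b1 * c1 = b2 * c2"
    and d: "d1 = d2"
    using assms(5)
    by (simp_all add: g k1 k2 jacobi_Ad_a det vec_eq_iff forall_2 a1_def a2_def c1_def c2_def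
        b1_def b2_def d1_def d2_def)
  have nz: "a1 \<noteq> 0 \<or> c1 \<noteq> 0" "a2 \<noteq> 0 \<or> c2 \<noteq> 0"
    using det by (auto simp: det_2 a1_def a2_def c1_def c2_def)
  have "\<exists>l. l \<noteq> 0 \<and> \<alpha>1 = l\<^sup>2 * \<alpha>2 \<and> b1 = l * b2"
  proof (cases "\<alpha>1 \<noteq> 0 \<or> b1 \<noteq> 0")
    case True
    then show ?thesis
      using nz(1) rescaling_factor[OF eqs(1,3)] rescaling_factor[OF eqs(2,4)] by blast
  next
    case False
    \<comment> \<open>A nonzero entry of the second column carries the vanishing over, so both
      translates are constant and the factor 1 will do.\<close>
    then have "\<alpha>2 = 0" "b2 = 0" using eqs nz(2) by auto
    with False show ?thesis by (auto intro: exI[of _ 1])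
  qed
  then obtain l where l: "l \<noteq> 0" "\<alpha>1 = l\<^sup>2 * \<alpha>2" "b1 = l * b2" by blast
  have "range (poly (jacobi_poly k1)) = range (poly [: - d1 / 4, b1, - \<alpha>1 :])"
    unfolding k1 jacobi_poly_coords b1_def d1_def by (rule range_poly_translate)
  also have "\<dots> = range (poly [: - d2 / 4, b2, - \<alpha>2 :])"
    unfolding d l(2,3) by (rule range_poly_rescale[OF l(1)])
  also have "\<dots> = range (poly (jacobi_poly k2))"
    unfolding k2 jacobi_poly_coords b2_def d2_def by (rule range_poly_translate[symmetric])
  finally show ?thesis .
qed

end
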